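(* Let $-\infty<a<b<\infty$. The primitive sequence map $S$ is injective: if $\mu_1,\mu_2\in\mathcal{P}_{[a,b]}$ are such that $S(\mu_1)=S(\mu_2)$, then $\mu_1=\mu_2$; thus, the sequence $\{\varepsilon_n(\mu)\}_n$ uniquely determines $\mu\in\mathcal{P}_{[a,b]}$.
   Context: $\mathcal{P}_{[a,b]}$ denotes the set of Borel probability measures on $[a,b]$. For $\mu\in\mathcal{P}_{[a,b]}$ and $n\ge0$ let $\varepsilon_n(\mu):=\frac1{n!}\int_{[a,b]}(b-x)^n\,\mu(dx)$ (with $0^0=1$). The primitive sequence map is $S:\mathcal{P}_{[a,b]}\to\prod_{n=0}^\infty\left[0,(b-a)^n/n!\right]$, $S(\mu)=\{\varepsilon_n(\mu)\}_{n\ge0}$. *)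

theory Defs imports "HOL-Probability.Probability" begin

definition prob_measures_on :: "real \<Rightarrow> real \<Rightarrow> real measure set" where
  "prob_measures_on a b =
    {\<mu>. prob_space \<mu> \<and> sets \<mu> = sets (restrict_space borel {a..b})}"

text \<open>The domain of integration is \<open>space \<mu>\<close>, which is \<open>{a..b}\<close> for
  \<open>\<mu> \<in> prob_measures_on a b\<close>; hence only \<open>b\<close> occurs as a parameter.\<close>

definition primitive_coeff :: "real \<Rightarrow> nat \<Rightarrow> real measure \<Rightarrow> real" where
  "primitive_coeff b n \<mu> = 1 / fact n * (\<integral>x. (b - x) ^ n \<partial>\<mu>)"

definition primitive_seq :: "real \<Rightarrow> real measure \<Rightarrow> nat \<Rightarrow> real" where
  "primitive_seq b \<mu> = (\<lambda>n. primitive_coeff b n \<mu>)"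

lemma space_prob_measures_on:
  assumes "\<mu> \<in> prob_measures_on a b"
  shows "space \<mu> = {a..b}"
  using assms sets_eq_imp_space_eq[of \<mu> "restrict_space borel {a..b}"]
  by (simp add: prob_measures_on_def space_restrict_space)

lemma integrable_prob_measures_on:
  assumes \<mu>: "\<mu> \<in> prob_measures_on a b"
  shows "integrable \<mu> (\<lambda>x. (b - x) ^ n)"
proof -
  interpret prob_space \<mu> using \<mu> by (simp add: prob_measures_on_def)
  have sets: "sets \<mu> = sets (restrict_space borel {a..b})"
    using \<mu> by (simp add: prob_measures_on_def)
  have "(\<lambda>x. (b - x) ^ n) \<in> borel_measurable (restrict_space borel {a..b})"
    by (intro measurable_restrict_space1) measurable
  then have meas: "(\<lambda>x. (b - x) ^ n) \<in> borel_measurable \<mu>"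
    using measurable_cong_sets[OF sets refl] by blast
  show ?thesis
  proof (rule integrable_const_bound[where B = "(b - a) ^ n", OF _ meas])
    show "AE x in \<mu>. norm ((b - x) ^ n) \<le> (b - a) ^ n"
      by (rule AE_I2)
        (auto simp: space_prob_measures_on[OF \<mu>] norm_power intro!: power_mono)
  qed
qed

lemma primitive_seq_range:
  assumes \<mu>: "\<mu> \<in> prob_measures_on a b"
  shows "primitive_seq b \<mu> \<in> (\<Pi> n\<in>UNIV. {0..(b - a) ^ n / fact n})"
proof -
  interpret prob_space \<mu> using \<mu> by (simp add: prob_measures_on_def)
  have "0 \<le> (\<integral>x. (b - x) ^ n \<partial>\<mu>)" for n
    by (rule Bochner_Integration.integral_nonneg)
      (simp add: space_prob_measures_on[OF \<mu>])
  moreover have "(\<integral>x. (b - x) ^ n \<partial>\<mu>) \<le> (b - a) ^ n" for n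
    by (rule integral_le_const[OF integrable_prob_measures_on[OF \<mu>]], rule AE_I2)
      (auto simp: space_prob_measures_on[OF \<mu>] intro!: power_mono)
  ultimately show ?thesis
    by (auto simp: primitive_seq_def primitive_coeff_def divide_right_mono)
qed

end

theory Submission imports Defs begin

text \<open>The coefficients \<open>n! \<epsilon>\<^sub>n(\<mu>)\<close> are the moments of the image of \<open>\<mu>\<close> under
  the reflection \<open>x \<mapsto> b - x\<close>. That image is a boundedly supported law, so its characteristic
  function is the sum of its moment series, and Levy's uniqueness theorem recovers the law, hence
  \<open>\<mu>\<close>.\<close>

text \<open>\<open>char_approx1\<close> bounds the Taylor remainder by an absolute moment, which
  bounded support limits to geometric growth; the factorial then wins for every
  \<open>t\<close>.\<close>

lemma (in real_distribution) char_moment_series: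
  assumes bounded: "AE x in M. \<bar>x\<bar> \<le> c"
  shows "(\<lambda>n. \<Sum>k\<le>n. (\<i> * t) ^ k / fact k * expectation (\<lambda>x. x ^ k)) \<longlonglongrightarrow> char M t"
proof -
  have int: "integrable M (\<lambda>x. x ^ k)" for k
  proof (rule integrable_const_bound)
    show "AE x in M. norm (x ^ k) \<le> c ^ k"
      using bounded by eventually_elim (simp add: power_abs power_mono)
  qed simp
  let ?S = "\<lambda>n. \<Sum>k\<le>n. (\<i> * t) ^ k / fact k * expectation (\<lambda>x. x ^ k)"
  have "cmod (?S n - char M t) \<le> 2 * (\<bar>t\<bar> * c) ^ n / fact n" for n
  proof -
    have "expectation (\<lambda>x. \<bar>x\<bar> ^ n) \<le> c ^ n"
    proof (rule integral_le_const)
      show "integrable M (\<lambda>x. \<bar>x\<bar> ^ n)"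
        using integrable_abs[OF int[of n]] by (simp add: power_abs)
      show "AE x in M. \<bar>x\<bar> ^ n \<le> c ^ n"
        using bounded by eventually_elim (simp add: power_mono)
    qed
    then have "2 * \<bar>t\<bar> ^ n / fact n * expectation (\<lambda>x. \<bar>x\<bar> ^ n)
        \<le> 2 * \<bar>t\<bar> ^ n / fact n * c ^ n"
      by (intro mult_left_mono) auto
    then show ?thesis
      using char_approx1[of n t] int
      by (simp add: norm_minus_commute power_mult_distrib mult_ac)
  qed
  \<comment> \<open>Up to the factor 2 these are the terms of the exponential series at
    \<open>\<bar>t\<bar> * c\<close>.\<close>
  moreover have "(\<lambda>n. 2 * (\<bar>t\<bar> * c) ^ n / fact n) \<longlonglongrightarrow> 0"
    using summable_LIMSEQ_zero[OF summable_exp[of "\<bar>t\<bar> * c"], THEN tendsto_mult_right_zero, of 2]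
    by (simp add: field_simps)
  ultimately have "(\<lambda>n. ?S n - char M t) \<longlonglongrightarrow> 0"
    by (rule Lim_null_comparison[OF always_eventually[OF allI]])
  then show ?thesis
    by (rule LIM_zero_cancel)
qed

lemma bounded_moments_determine_distribution:
  assumes "real_distribution M" "real_distribution N"
    and "AE x in M. \<bar>x\<bar> \<le> c" "AE x in N. \<bar>x\<bar> \<le> c"
    and moments: "\<And>n. (\<integral>x. x ^ n \<partial>M) = (\<integral>x. x ^ n \<partial>N)"
  shows "M = N"
proof (rule Levy_uniqueness)
  show "char M = char N"
  proof
    fix t
    \<comment> \<open>Rewriting with \<open>moments\<close> turns the two partial-sum sequences into
      one, whose limit is unique.\<close>
    show "char M t = char N t"
      using real_distribution.char_moment_series[OF assms(1,3), of t]
        real_distribution.char_moment_series[OF assms(2,4), of t]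
      unfolding moments by (rule LIMSEQ_unique)
  qed
qed fact+

theorem lemma3:
  fixes a b :: real
  assumes "a < b"
  shows "inj_on (primitive_seq b) (prob_measures_on a b)"
proof (rule inj_onI)
  fix \<mu> \<nu>
  assume \<mu>: "\<mu> \<in> prob_measures_on a b" and \<nu>: "\<nu> \<in> prob_measures_on a b"
    and eq: "primitive_seq b \<mu> = primitive_seq b \<nu>"
  let ?r = "\<lambda>x::real. b - x"
  let ?D = "\<lambda>\<mu>. distr \<mu> borel ?r"
  \<comment> \<open>\<open>\<kappa>\<close> carries the trace sigma-algebra on
    \<open>{a..b}\<close>; measurability is read off from integrability with exponent 1.\<close>
  have meas: "?r \<in> borel_measurable \<kappa>" if "\<kappa> \<in> prob_measures_on a b" for \<kappa>
    using borel_measurable_integrable[OF integrable_prob_measures_on[OF that, of 1]] by simp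
  have dist: "real_distribution (?D \<kappa>)" if "\<kappa> \<in> prob_measures_on a b" for \<kappa>
    using that meas[OF that]
    by (auto simp: prob_measures_on_def intro: prob_space.real_distribution_distr)
  have bounded: "AE x in ?D \<kappa>. \<bar>x\<bar> \<le> b - a" if "\<kappa> \<in> prob_measures_on a b" for \<kappa>
    using meas[OF that] by (auto simp: AE_distr_iff space_prob_measures_on[OF that])
  have "?D \<mu> = ?D \<nu>"
  proof (rule bounded_moments_determine_distribution)
    \<comment> \<open>Change of variables turns the \<open>n\<close>-th moment of the image into the
      integral in \<open>primitive_coeff\<close>, and the nonzero factor \<open>1 / fact n\<close>
      cancels.\<close>
    fix n
    have "primitive_coeff b n \<mu> = primitive_coeff b n \<nu>"
      using fun_cong[OF eq, of n] by (simp add: primitive_seq_def)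
    then show "(\<integral>x. x ^ n \<partial>?D \<mu>) = (\<integral>x. x ^ n \<partial>?D \<nu>)"
      using meas[OF \<mu>] meas[OF \<nu>] by (simp add: integral_distr primitive_coeff_def)
  qed (use dist bounded \<mu> \<nu> in auto)
  \<comment> \<open>The reflection is an involution, so pulling \<open>A\<close> back twice returns
    \<open>A\<close>.\<close>
  have recover: "emeasure \<kappa> A = emeasure (?D \<kappa>) (?r -` A)"
    if \<kappa>: "\<kappa> \<in> prob_measures_on a b" and A: "A \<in> sets \<kappa>" for \<kappa> A
  proof -
    \<comment> \<open>The image law lives on the whole line; trace sets are Borel there because
      \<open>{a..b}\<close> is.\<close>
    have "A \<in> sets borel"
      using \<kappa> A by (auto simp: prob_measures_on_def sets_restrict_space)
    then have "?r -` A \<in> sets borel"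
      using measurable_sets[of ?r borel borel A] by simp
    moreover have "?r -` (?r -` A) \<inter> space \<kappa> = A"
      using sets.sets_into_space[OF A] by auto
    ultimately show ?thesis
      using meas[OF \<kappa>] by (simp add: emeasure_distr)
  qed
  have "sets \<mu> = sets \<nu>"
    using \<mu> \<nu> by (simp add: prob_measures_on_def)
  then show "\<mu> = \<nu>"
    using recover[OF \<mu>] recover[OF \<nu>] \<open>?D \<mu> = ?D \<nu>\<close> by (intro measure_eqI) simp_all
qed

end
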